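(* Let $(\underline P,\overline P)$ be a Vertical Barrier Model on $\mathcal A(\mathbb P)$, let $A\in\mathcal A(\mathbb P)$, let $\mathcal B\subset\mathcal A(\mathbb P)\setminus\{\emptyset\}$ be a partition, and let $\mathcal B_0=\{B\in\mathcal B:\underline P(B)=0\}$. Suppose $\mathcal B_0\neq\varnothing$ and that there exists $B^*\in\mathcal B_0$ such that $B^*\not\Rightarrow A$ and $B^*\not\Rightarrow A^{\mathsf c}$. Then $\mathcal B$ constricts $A$ if and only if $\underline P(A)=0$, $\overline P(A)=1$, and there is $B'\in\mathcal B_0$ such that either $B'\Rightarrow A$ or $B'\Rightarrow A^{\mathsf c}$.
   Context: Let $\mathbb P$ be a partition (finite or infinite) of the sure event $\Omega$ and $\mathcal A(\mathbb P)$ the set of events logically dependent on $\mathbb P$, i.e. (identifying events with sets) the power set of $\mathbb P$, with $\Omega$ the whole set, $\emptyset$ the impossible event, $\wedge,{}^{\mathsf c}$ intersection and complement, and $A\Rightarrow B$ meaning $A\subseteq B$. A partition $\mathcal B\subset\mathcal A(\mathbb P)\setminus\{\emptyset\}$ is a family of pairwise disjoint non-empty events whose union is $\Omega$. "Probability" means finitely additive probability on $\mathcal A(\mathbb P)$. Vertical Barrier Model (VBM): given a probability $P_0$ on $\mathcal A(\mathbb P)$ and $b>0$, $a\le 0$ with $0\le a+b\le 1$, and $c=1-(a+b)$, put $\underline P(A)=\max\{bP_0(A)+a,0\}$ for $A\ne\Omega$, $\underline P(\Omega)=1$; $\overline P(A)=\min\{bP_0(A)+c,1\}$ for $A\ne\emptyset$,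 $\overline P(\emptyset)=0$. Natural extension: let $\mathcal M=\{P \text{ probability on }\mathcal A(\mathbb P): P\ge\underline P\}$. For $B\ne\emptyset$, let $\mathcal M_B$ be the set of pairs $(P,P(\cdot|B))$ with $P\in\mathcal M$ and $P(\cdot|B)$ a probability on $\mathcal A(\mathbb P)$ satisfying $P(B|B)=1$ and $P(A\wedge B)=P(A|B)P(B)$ for all $A\in\mathcal A(\mathbb P)$. Then $\underline E(A|B)=\inf_{\mathcal M_B}P(A|B)$ and $\overline E(A|B)=\sup_{\mathcal M_B}P(A|B)$. $\mathcal B$ constricts $A$ if $\underline P(A)\le\underline E(A|B)\le\overline E(A|B)\le\overline P(A)$ for all $B\in\mathcal B$, with at least one of the outer inequalities being strict for at least one $B\in\mathcal B$. *)

theory Defs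
  imports Complex_Main "HOL-Library.Disjoint_Sets"
begin

text \<open>
  The atoms of the partition of the sure event are the elements of an arbitrary (finite or
  infinite) type \<open>'a\<close>. The events logically dependent on the partition are all sets of atoms,
  so the sure event is \<open>UNIV\<close> and \<open>A \<Rightarrow> B\<close> reads \<open>A \<subseteq> B\<close>.
\<close>

text \<open>Finitely additive probabilities on the power set; no countable additivity.\<close>

definition fa_prob :: "('a set \<Rightarrow> real) \<Rightarrow> bool" where
  "fa_prob P \<longleftrightarrow>
     (\<forall>A. 0 \<le> P A) \<and> P UNIV = 1 \<and> (\<forall>A B. A \<inter> B = {} \<longrightarrow> P (A \<union> B) = P A + P B)"

definition vbm_lower :: "('a set \<Rightarrow> real) \<Rightarrow> real \<Rightarrow> real \<Rightarrow> 'a set \<Rightarrow> real" where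
  "vbm_lower P0 a b A = (if A = UNIV then 1 else max (b * P0 A + a) 0)"

definition vbm_upper :: "('a set \<Rightarrow> real) \<Rightarrow> real \<Rightarrow> real \<Rightarrow> 'a set \<Rightarrow> real" where
  "vbm_upper P0 a b A = (if A = {} then 0 else min (b * P0 A + (1 - (a + b))) 1)"

definition vertical_barrier_model :: "('a set \<Rightarrow> real) \<Rightarrow> ('a set \<Rightarrow> real) \<Rightarrow> bool" where
  "vertical_barrier_model lP uP \<longleftrightarrow>
     (\<exists>P0 a b. fa_prob P0 \<and> 0 < b \<and> a \<le> 0 \<and> 0 \<le> a + b \<and> a + b \<le> 1 \<and>
        lP = vbm_lower P0 a b \<and> uP = vbm_upper P0 a b)"

definition credal_set :: "('a set \<Rightarrow> real) \<Rightarrow> ('a set \<Rightarrow> real) set" where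
  "credal_set lP = {P. fa_prob P \<and> (\<forall>A. lP A \<le> P A)}"

text \<open>
  In a pair \<open>(P, Q)\<close> below, \<open>Q\<close> stands for \<open>P(\<cdot>|B)\<close>. It is determined by \<open>P\<close> when
  \<open>P B > 0\<close>; when \<open>P B = 0\<close> it is any probability concentrated on \<open>B\<close>.
\<close>

definition cond_credal_set ::
  "('a set \<Rightarrow> real) \<Rightarrow> 'a set \<Rightarrow> (('a set \<Rightarrow> real) \<times> ('a set \<Rightarrow> real)) set" where
  "cond_credal_set lP B =
     {(P, Q). P \<in> credal_set lP \<and> fa_prob Q \<and> Q B = 1 \<and> (\<forall>A. P (A \<inter> B) = Q A * P B)}"

text \<open>
  The infimum and supremum are taken in the reals, hence are meaningful only if
  \<open>cond_credal_set lP B\<close> is nonempty. This holds for \<open>B \<noteq> {}\<close> and \<open>lP\<close> the lower probability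
  of a vertical barrier model: \<open>P0\<close> itself dominates \<open>lP\<close>. The values lie in \<open>[0, 1]\<close>.
\<close>

definition lower_ext :: "('a set \<Rightarrow> real) \<Rightarrow> 'a set \<Rightarrow> 'a set \<Rightarrow> real" where
  "lower_ext lP A B = (INF (P, Q)\<in>cond_credal_set lP B. Q A)"

definition upper_ext :: "('a set \<Rightarrow> real) \<Rightarrow> 'a set \<Rightarrow> 'a set \<Rightarrow> real" where
  "upper_ext lP A B = (SUP (P, Q)\<in>cond_credal_set lP B. Q A)"

definition constricts ::
  "('a set \<Rightarrow> real) \<Rightarrow> ('a set \<Rightarrow> real) \<Rightarrow> 'a set set \<Rightarrow> 'a set \<Rightarrow> bool" where
  "constricts lP uP \<B> A \<longleftrightarrow>
     (\<forall>B\<in>\<B>. lP A \<le> lower_ext lP A B \<and> lower_ext lP A B \<le> upper_ext lP A B \<and>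
             upper_ext lP A B \<le> uP A) \<and>
     (\<exists>B\<in>\<B>. lP A < lower_ext lP A B \<or> upper_ext lP A B < uP A)"

end

theory Submission imports Defs begin

text \<open>
  Any event \<open>E\<close> with \<open>lP E = 0\<close> has probability zero under some \<open>P\<close> dominating \<open>lP\<close>:
  restrict \<open>b P0\<close> to the complement of \<open>E\<close> and bring its total mass to \<open>1\<close>, by adding a point mass
  outside \<open>E\<close> if it is too small and by rescaling if it is too large. If \<open>lP B = 0\<close>, this leaves \<open>P(\<cdot>|B)\<close> unrestricted, so the
  natural extension of \<open>A\<close> given \<open>B\<close> is vacuous unless \<open>B\<close> decides \<open>A\<close>. If \<open>lP B > 0\<close> and
  \<open>lP A = 0\<close>, taking \<open>E = A \<inter> B\<close> gives \<open>P(A|B) = 0\<close>; dually \<open>P(A|B) = 1\<close> is attained when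
  \<open>uP A = 1\<close>. Hence \<open>B\<^sup>*\<close> forces the bounds on \<open>A\<close> to be vacuous, and then only an event of
  zero lower probability that decides \<open>A\<close> can give a strict inequality.
\<close>

lemma fa_prob_nonneg: "fa_prob P \<Longrightarrow> 0 \<le> P A"
  by (simp add: fa_prob_def)

lemma fa_prob_UNIV: "fa_prob P \<Longrightarrow> P UNIV = 1"
  by (simp add: fa_prob_def)

lemma fa_prob_Un: "fa_prob P \<Longrightarrow> A \<inter> B = {} \<Longrightarrow> P (A \<union> B) = P A + P B"
  by (simp add: fa_prob_def)

lemma fa_prob_empty: "fa_prob P \<Longrightarrow> P {} = 0"
  using fa_prob_Un[of P "{}" "{}"] by simp

lemma fa_prob_compl: "fa_prob P \<Longrightarrow> P (- A) = 1 - P A"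
  using fa_prob_Un[of P A "- A"] fa_prob_UNIV[of P] by simp

lemma fa_prob_split: "fa_prob P \<Longrightarrow> P A = P (A \<inter> B) + P (A \<inter> - B)"
  using fa_prob_Un[of P "A \<inter> B" "A \<inter> - B"] by (simp add: Int_Un_distrib[symmetric] disjoint_iff)

lemma fa_prob_mono:
  assumes "fa_prob P" "A \<subseteq> B"
  shows "P A \<le> P B"
proof -
  have "P B = P A + P (B \<inter> - A)"
    using fa_prob_split[OF assms(1), of B A] assms(2) by (simp add: Int_absorb1)
  then show ?thesis
    using fa_prob_nonneg[OF assms(1)] by (smt (verit))
qed

lemma fa_prob_le_1: "fa_prob P \<Longrightarrow> P A \<le> 1"
  using fa_prob_mono[of P A UNIV] fa_prob_UNIV[of P] by simp

text \<open>Serves as the conditional probability given a null event \<open>B\<close>, with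
  \<open>x\<close> a point of \<open>B\<close>.\<close>

lemma fa_prob_dirac: "fa_prob (\<lambda>C. of_bool (x \<in> C))"
  by (auto simp: fa_prob_def)

lemma fa_prob_conditional:
  assumes "fa_prob P" "0 < P B"
  shows "fa_prob (\<lambda>C. P (C \<inter> B) / P B)"
proof -
  have "P ((C \<union> D) \<inter> B) = P (C \<inter> B) + P (D \<inter> B)" if "C \<inter> D = {}" for C D
    using fa_prob_Un[OF assms(1), of "C \<inter> B" "D \<inter> B"] that
    by (simp add: Int_Un_distrib2 disjoint_iff)
  then show ?thesis
    using assms by (auto simp: fa_prob_def add_divide_distrib)
qed

lemma credal_set_vbm_null:
  fixes P0 :: "'a set \<Rightarrow> real"
  assumes P0: "fa_prob P0" and ab: "0 < b" "a \<le> 0" "a + b \<le> 1"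
    and E: "vbm_lower P0 a b E = 0"
  shows "\<exists>P\<in>credal_set (vbm_lower P0 a b). P E = 0"
proof -
  have null: "b * P0 E + a \<le> 0" and "E \<noteq> UNIV"
    using E by (auto simp: vbm_lower_def max_def split: if_splits)
  then obtain x where x: "x \<notin> E" by auto
  define m where "m = P0 (- E)"
  have PE: "P0 E = 1 - m" using fa_prob_compl[OF P0, of E] by (simp add: m_def)
  have rest: "P0 (C \<inter> - E) \<le> m" for C
    unfolding m_def by (rule fa_prob_mono[OF P0]) auto
  \<comment> \<open>Split \<open>P0 C\<close> along \<open>E\<close>. The last bracket equals
    \<open>b * P0 E + a\<close>, which is nonpositive by \<open>null\<close>.\<close>
  have bound: "b * P0 C + a \<le> b * P0 (C \<inter> - E) + (b * (1 - m) + a)" for C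
  proof -
    have "P0 (C \<inter> E) \<le> 1 - m"
      using fa_prob_mono[OF P0, of "C \<inter> E" E] PE by simp
    then have "b * P0 (C \<inter> E) \<le> b * (1 - m)" using ab by simp
    then show ?thesis
      using fa_prob_split[OF P0, of C E] by (simp add: distrib_left)
  qed
  show ?thesis
  proof (cases "b * m < 1")
    case True
    let ?P = "\<lambda>C. b * P0 (C \<inter> - E) + (1 - b * m) * of_bool (x \<in> C)"
    have "P0 ((C \<union> D) \<inter> - E) = P0 (C \<inter> - E) + P0 (D \<inter> - E)" if "C \<inter> D = {}" for C D
      using fa_prob_Un[OF P0, of "C \<inter> - E" "D \<inter> - E"] that
      by (simp add: Int_Un_distrib2 disjoint_iff)
    moreover have "0 \<le> ?P C" for C
      using True ab fa_prob_nonneg[OF P0, of "C \<inter> - E"] by simp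
    ultimately have fa: "fa_prob ?P"
      by (auto simp: fa_prob_def m_def algebra_simps)
    have "vbm_lower P0 a b C \<le> ?P C" for C
    proof -
      have "b * P0 C + a \<le> b * P0 (C \<inter> - E)" using bound[of C] null PE by simp
      moreover have "0 \<le> (1 - b * m) * of_bool (x \<in> C)" using True by simp
      ultimately show ?thesis
        using fa_prob_nonneg[OF fa, of C] fa_prob_UNIV[OF fa]
        by (auto simp: vbm_lower_def)
    qed
    then show ?thesis
      using fa x fa_prob_empty[OF P0] by (intro bexI[of _ ?P]) (auto simp: credal_set_def)
  next
    case False
    then have "m > 0"
      using ab fa_prob_nonneg[OF P0, of "- E"] by (cases "m = 0") (auto simp: m_def)
    \<comment> \<open>The factor \<open>b\<close> cancels when \<open>b * P0\<close> restricted to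
      \<open>- E\<close> is rescaled to total mass \<open>1\<close>, leaving \<open>P0\<close>
      conditioned on \<open>- E\<close>.\<close>
    let ?P = "\<lambda>C. P0 (C \<inter> - E) / m"
    have fa: "fa_prob ?P"
      using fa_prob_conditional[OF P0, of "- E"] \<open>m > 0\<close> by (simp add: m_def)
    have "vbm_lower P0 a b C \<le> ?P C" for C
    proof -
      define t where "t = ?P C"
      have t: "0 \<le> t" "t \<le> 1" "P0 (C \<inter> - E) = t * m"
        using fa_prob_nonneg[OF fa] fa_prob_le_1[OF fa] \<open>m > 0\<close> by (auto simp: t_def)
      \<comment> \<open>With \<open>s = b * (1 - m) + a\<close>, the right side of
        \<open>bound\<close> is \<open>t * (b * m) + s = t * (a + b) + (1 - t) * s\<close>; the two
        terms are bounded by \<open>t\<close> and \<open>0\<close>.\<close>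
      have "(1 - t) * (b * (1 - m) + a) \<le> 0"
        using t null PE by (simp add: mult_nonneg_nonpos)
      moreover have "t * (a + b) \<le> t * 1"
        using t ab by (intro mult_left_mono)
      ultimately have "b * P0 C + a \<le> t"
        using bound[of C] t(3) by (simp add: algebra_simps)
      then show ?thesis
        using t(1) fa_prob_UNIV[OF fa] by (auto simp: vbm_lower_def t_def)
    qed
    then show ?thesis
      using fa fa_prob_empty[OF P0] by (intro bexI[of _ ?P]) (auto simp: credal_set_def)
  qed
qed

text \<open>By monotonicity \<open>P\<close> vanishes on every part of \<open>B\<close>, so the
  product rule reads \<open>0 = 0\<close> for any \<open>Q\<close>.\<close>

lemma cond_credal_setI_null:
  assumes P: "P \<in> credal_set lP" "P B = 0" and Q: "fa_prob Q" "Q B = 1"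
  shows "(P, Q) \<in> cond_credal_set lP B"
proof -
  have fa: "fa_prob P" using P by (simp add: credal_set_def)
  have "P (A \<inter> B) = 0" for A
    using fa_prob_mono[OF fa, of "A \<inter> B" B] fa_prob_nonneg[OF fa, of "A \<inter> B"] P by simp
  then show ?thesis using P Q by (simp add: cond_credal_set_def)
qed

lemma cond_credal_setI_pos:
  assumes "P \<in> credal_set lP" "0 < P B"
  shows "(P, \<lambda>C. P (C \<inter> B) / P B) \<in> cond_credal_set lP B"
  using assms fa_prob_conditional[of P B] by (auto simp: cond_credal_set_def credal_set_def)

text \<open>Provides the boundedness that real infima and suprema require.\<close>

lemma cond_credal_set_range:
  assumes "(P, Q) \<in> cond_credal_set lP B"
  shows "0 \<le> Q A" "Q A \<le> 1"
  using assms fa_prob_nonneg fa_prob_le_1 by (auto simp: cond_credal_set_def)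

lemma lower_ext_le:
  assumes "(P, Q) \<in> cond_credal_set lP B"
  shows "lower_ext lP A B \<le> Q A"
  unfolding lower_ext_def
  by (rule cINF_lower2[OF _ assms]) (auto intro!: bdd_belowI2[of _ 0] cond_credal_set_range)

lemma le_upper_ext:
  assumes "(P, Q) \<in> cond_credal_set lP B"
  shows "Q A \<le> upper_ext lP A B"
  unfolding upper_ext_def
  by (rule cSUP_upper2[OF _ assms]) (auto intro!: bdd_aboveI2[of _ _ 1] cond_credal_set_range)

lemma le_lower_ext:
  assumes "cond_credal_set lP B \<noteq> {}" "\<And>P Q. (P, Q) \<in> cond_credal_set lP B \<Longrightarrow> c \<le> Q A"
  shows "c \<le> lower_ext lP A B"
  unfolding lower_ext_def using assms by (intro cINF_greatest) auto

lemma upper_ext_le: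
  assumes "cond_credal_set lP B \<noteq> {}" "\<And>P Q. (P, Q) \<in> cond_credal_set lP B \<Longrightarrow> Q A \<le> c"
  shows "upper_ext lP A B \<le> c"
  unfolding upper_ext_def using assms by (intro cSUP_least) auto

lemma cond_credal_set_vbm_nonempty:
  assumes P0: "fa_prob P0" and ab: "0 < b" "a \<le> 0" "a + b \<le> 1" and "B \<noteq> {}"
  shows "cond_credal_set (vbm_lower P0 a b) B \<noteq> {}"
proof -
  \<comment> \<open>The null event \<open>{}\<close> serves only to produce some member of the
    credal set.\<close>
  have "vbm_lower P0 a b {} = 0"
    using ab fa_prob_empty[OF P0] by (simp add: vbm_lower_def)
  then obtain P where P: "P \<in> credal_set (vbm_lower P0 a b)"
    using credal_set_vbm_null[OF P0 ab] by blast
  show ?thesis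
  proof (cases "P B = 0")
    case True
    from \<open>B \<noteq> {}\<close> obtain y where "y \<in> B" by auto
    then show ?thesis using cond_credal_setI_null[OF P True fa_prob_dirac, of y] by auto
  next
    case False
    have "0 \<le> P B" using P fa_prob_nonneg by (auto simp: credal_set_def)
    then show ?thesis using cond_credal_setI_pos[OF P, of B] False by auto
  qed
qed

text \<open>Handles both bounds at once: used for \<open>A\<close> it pushes the lower extension
  down to \<open>0\<close>, used for \<open>- A\<close> it pushes the upper extension up to
  \<open>1\<close>.\<close>

lemma cond_credal_set_vbm_vanishing:
  assumes P0: "fa_prob P0" and ab: "0 < b" "a \<le> 0" "a + b \<le> 1"
    and A: "vbm_lower P0 a b A = 0 \<or> vbm_lower P0 a b B = 0"
    and B: "vbm_lower P0 a b B = 0 \<longrightarrow> \<not> B \<subseteq> A"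
  shows "\<exists>P Q. (P, Q) \<in> cond_credal_set (vbm_lower P0 a b) B \<and> Q A = 0"
proof (cases "vbm_lower P0 a b B = 0")
  case True
  then obtain P where P: "P \<in> credal_set (vbm_lower P0 a b)" "P B = 0"
    using credal_set_vbm_null[OF P0 ab] by blast
  obtain y where "y \<in> B" "y \<notin> A" using B True by auto
  then show ?thesis using cond_credal_setI_null[OF P fa_prob_dirac, of y] by fastforce
next
  case False
  then have A0: "vbm_lower P0 a b A = 0" using A by simp
  \<comment> \<open>Both facts pass to the subset \<open>A \<inter> B\<close>; the first is needed
    because \<open>vbm_lower\<close> jumps to \<open>1\<close> at \<open>UNIV\<close>.\<close>
  then have "A \<noteq> UNIV" "b * P0 A + a \<le> 0"
    by (auto simp: vbm_lower_def max_def split: if_splits)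
  moreover have "b * P0 (A \<inter> B) \<le> b * P0 A"
    using ab fa_prob_mono[OF P0, of "A \<inter> B" A] by simp
  ultimately have "vbm_lower P0 a b (A \<inter> B) = 0" by (auto simp: vbm_lower_def)
  then obtain P where P: "P \<in> credal_set (vbm_lower P0 a b)" "P (A \<inter> B) = 0"
    using credal_set_vbm_null[OF P0 ab] by blast
  \<comment> \<open>Every member of the credal set is positive on \<open>B\<close>, so the quotient
    defines the conditional probability.\<close>
  have "0 < vbm_lower P0 a b B" using False by (auto simp: vbm_lower_def max_def split: if_splits)
  also have "\<dots> \<le> P B" using P by (simp add: credal_set_def)
  finally have "0 < P B" .
  then show ?thesis using cond_credal_setI_pos[OF P(1)] P(2) by fastforce
qed

theorem proposition5p6:
  fixes lP uP :: "'a set \<Rightarrow> real"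
    and A :: "'a set"
    and \<B> \<B>\<^sub>0 :: "'a set set"
  assumes "vertical_barrier_model lP uP"
    and "partition_on UNIV \<B>"
    and "\<B>\<^sub>0 = {B \<in> \<B>. lP B = 0}"
    and "\<B>\<^sub>0 \<noteq> {}"
    and "\<exists>B\<in>\<B>\<^sub>0. \<not> B \<subseteq> A \<and> \<not> B \<subseteq> - A"
  shows "constricts lP uP \<B> A \<longleftrightarrow>
    lP A = 0 \<and> uP A = 1 \<and> (\<exists>B'\<in>\<B>\<^sub>0. B' \<subseteq> A \<or> B' \<subseteq> - A)"
proof -
  obtain P0 a b where P0: "fa_prob P0" and ab: "0 < b" "a \<le> 0" "a + b \<le> 1"
    and lP: "lP = vbm_lower P0 a b" and uP: "uP = vbm_upper P0 a b"
    using assms(1) unfolding vertical_barrier_model_def by blast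
  have nonempty: "cond_credal_set lP B \<noteq> {}" if "B \<in> \<B>" for B
    using cond_credal_set_vbm_nonempty[OF P0 ab, of B] partition_onD3[OF assms(2)] that
    unfolding lP by metis
  have range: "0 \<le> lP A" "uP A \<le> 1"
    by (auto simp: lP uP vbm_lower_def vbm_upper_def)
  have lower0: "lower_ext lP A B \<le> 0"
    if null: "lP A = 0 \<or> lP B = 0" "lP B = 0 \<longrightarrow> \<not> B \<subseteq> A" for B
  proof -
    obtain P Q where PQ: "(P, Q) \<in> cond_credal_set lP B" "Q A = 0"
      using cond_credal_set_vbm_vanishing[OF P0 ab, of A B] null unfolding lP by blast
    then show ?thesis using lower_ext_le[OF PQ(1), of A] by simp
  qed
  have upper1: "1 \<le> upper_ext lP A B"
    if null: "lP (- A) = 0 \<or> lP B = 0" "lP B = 0 \<longrightarrow> \<not> B \<subseteq> - A" for B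
  proof -
    obtain P Q where PQ: "(P, Q) \<in> cond_credal_set lP B" "Q (- A) = 0"
      using cond_credal_set_vbm_vanishing[OF P0 ab, of "- A" B] null unfolding lP by blast
    then have "Q A = 1" using fa_prob_compl[of Q A] by (simp add: cond_credal_set_def)
    then show ?thesis using le_upper_ext[OF PQ(1), of A] by simp
  qed
  \<comment> \<open>An instance of the conjugacy \<open>lP (- A) = 1 - uP A\<close>, which the
    constant \<open>1 - (a + b)\<close> ensures.\<close>
  have conj: "lP (- A) = 0" if "uP A = 1"
  proof -
    have "A \<noteq> {}" "1 \<le> b * P0 A + (1 - (a + b))"
      using that by (auto simp: uP vbm_upper_def min_def split: if_splits)
    moreover have "b * P0 (- A) + a = b + a - b * P0 A"
      by (simp add: fa_prob_compl[OF P0] algebra_simps)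
    ultimately show ?thesis
      by (auto simp: lP vbm_lower_def)
  qed
  show ?thesis
  proof
    assume c: "constricts lP uP \<B> A"
    obtain B where B: "B \<in> \<B>" "lP B = 0" "\<not> B \<subseteq> A" "\<not> B \<subseteq> - A"
      using assms(3,5) by auto
    have "lP A \<le> lower_ext lP A B" "upper_ext lP A B \<le> uP A"
      using c B(1) unfolding constricts_def by auto
    \<comment> \<open>The extension given \<open>B\<close> is vacuous, so constriction squeezes
      \<open>lP A\<close> to \<open>0\<close> and \<open>uP A\<close> to \<open>1\<close>.\<close>
    then have A: "lP A = 0" "uP A = 1"
      using lower0[of B] upper1[of B] B range by auto
    obtain B' where B': "B' \<in> \<B>" "0 < lower_ext lP A B' \<or> upper_ext lP A B' < 1"
      using c A unfolding constricts_def by auto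
    have "lP B' = 0 \<and> (B' \<subseteq> A \<or> B' \<subseteq> - A)"
    proof (rule ccontr)
      \<comment> \<open>Either \<open>lP B' \<noteq> 0\<close> or \<open>B'\<close> meets both
        \<open>A\<close> and \<open>- A\<close>; since \<open>lP A\<close> and
        \<open>lP (- A)\<close> are both \<open>0\<close>, \<open>lower0\<close> and
        \<open>upper1\<close> apply in each case.\<close>
      assume "\<not> ?thesis"
      then have "lower_ext lP A B' \<le> 0" "1 \<le> upper_ext lP A B'"
        using A(1) conj[OF A(2)] by (blast intro: lower0 upper1)+
      with B'(2) show False by simp
    qed
    with A B'(1) show "lP A = 0 \<and> uP A = 1 \<and> (\<exists>B'\<in>\<B>\<^sub>0. B' \<subseteq> A \<or> B' \<subseteq> - A)"
      unfolding assms(3) by auto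
  next
    assume A: "lP A = 0 \<and> uP A = 1 \<and> (\<exists>B'\<in>\<B>\<^sub>0. B' \<subseteq> A \<or> B' \<subseteq> - A)"
    then obtain B' where B': "B' \<in> \<B>" "B' \<subseteq> A \<or> B' \<subseteq> - A"
      unfolding assms(3) by auto
    \<comment> \<open>As \<open>lP A = 0\<close> and \<open>uP A = 1\<close>, the weak inequalities
      of constriction are just bounds in \<open>[0, 1]\<close>; any common pair puts the infimum
      below the supremum.\<close>
    have order: "0 \<le> lower_ext lP A B \<and> lower_ext lP A B \<le> upper_ext lP A B \<and> upper_ext lP A B \<le> 1"
      if "B \<in> \<B>" for B
    proof -
      obtain P Q where PQ: "(P, Q) \<in> cond_credal_set lP B" using nonempty[OF \<open>B \<in> \<B>\<close>] by auto
      have "0 \<le> lower_ext lP A B"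
        using nonempty[OF that] by (rule le_lower_ext) (rule cond_credal_set_range)
      moreover have "upper_ext lP A B \<le> 1"
        using nonempty[OF that] by (rule upper_ext_le) (rule cond_credal_set_range)
      ultimately show ?thesis
        using lower_ext_le[OF PQ, of A] le_upper_ext[OF PQ, of A] by simp
    qed
    \<comment> \<open>Every admissible \<open>Q\<close> is concentrated on \<open>B'\<close>, so
      \<open>Q A\<close> is \<open>1\<close> throughout if \<open>B' \<subseteq> A\<close> and
      \<open>0\<close> throughout if \<open>B' \<subseteq> - A\<close>.\<close>
    have "lP A < lower_ext lP A B' \<or> upper_ext lP A B' < uP A"
      using B'(2)
    proof
      assume sub: "B' \<subseteq> A"
      have "1 \<le> Q A" if "(P, Q) \<in> cond_credal_set lP B'" for P Q
        using that fa_prob_mono[OF _ sub, of Q] by (simp add: cond_credal_set_def)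
      then have "1 \<le> lower_ext lP A B'" by (rule le_lower_ext[OF nonempty[OF B'(1)]])
      with A show ?thesis by simp
    next
      assume sub: "B' \<subseteq> - A"
      have "Q A \<le> 0" if "(P, Q) \<in> cond_credal_set lP B'" for P Q
        using that fa_prob_mono[OF _ sub, of Q] fa_prob_compl[of Q A]
        by (simp add: cond_credal_set_def)
      then have "upper_ext lP A B' \<le> 0" by (rule upper_ext_le[OF nonempty[OF B'(1)]])
      with A show ?thesis by simp
    qed
    with A B'(1) order show "constricts lP uP \<B> A" unfolding constricts_def by auto
  qed
qed

end
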